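(* Let $G$ be a finite 2-edge-connected graph and $k\ge 2$ an integer. If the reconfiguration graph $\mathcal{F}(G,k)$ is non-empty, then every vertex of $\mathcal{F}(G,k)$ has degree at least $1$.
   Context: Graphs may have multiple edges but no loops. Fix an orientation $D$ of the edges of $G$. A $\mathbb{Z}$-flow in $G$ is a map $f:E(G)\to\mathbb{Z}$ such that at every vertex $v$, the sum of $f(e)$ over arcs with tail $v$ equals the sum over arcs with head $v$. A $k$-flow is a $\mathbb{Z}$-flow with $|f(e)|<k$ for all edges $e$; it is nowhere-zero if $f(e)\ne 0$ for all $e$. The support $\mathrm{supp}(f)$ is the set of edges with non-zero value. A cycle is a connected 2-regular subgraph. The reconfiguration graph $\mathcal{F}(G,k)$ has as vertices all nowhere-zero $k$-flows of $G$ (with respect to the fixed orientation), two flows $f,g$ being adjacent if $\mathrm{supp}(f-g)$ is the edge set of a cycle of $G$. *)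

theory Defs
  imports "Graph_Theory.Digraph" "HOL-Library.FuncSet"
begin

section \<open>Loopless multigraphs\<close>

record ('v, 'e) pre_multigraph =
  mverts :: "'v set"
  medges :: "'e set"
  mends :: "'e \<Rightarrow> 'v set"

text \<open>Edges are named objects, so parallel edges are allowed; each has exactly two
  ends, so there are no loops.\<close>

locale multigraph =
  fixes G :: "('v, 'e) pre_multigraph"
  assumes mends_in_mverts: "e \<in> medges G \<Longrightarrow> mends G e \<subseteq> mverts G"
    and card_mends: "e \<in> medges G \<Longrightarrow> card (mends G e) = 2"

locale finite_multigraph = multigraph +
  assumes finite_mverts: "finite (mverts G)"
    and finite_medges: "finite (medges G)"

definition mdegree :: "('v, 'e) pre_multigraph \<Rightarrow> 'v \<Rightarrow> nat" where
  "mdegree G v = card {e \<in> medges G. v \<in> mends G e}"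

definition madjacent :: "('v, 'e) pre_multigraph \<Rightarrow> ('v \<times> 'v) set" where
  "madjacent G = {(u, v). \<exists>e \<in> medges G. mends G e = {u, v}}"

definition mconnected :: "('v, 'e) pre_multigraph \<Rightarrow> bool" where
  "mconnected G \<longleftrightarrow>
     mverts G \<noteq> {} \<and> (\<forall>u \<in> mverts G. \<forall>v \<in> mverts G. (u, v) \<in> (madjacent G)\<^sup>*)"

definition del_edges :: "('v, 'e) pre_multigraph \<Rightarrow> 'e set \<Rightarrow> ('v, 'e) pre_multigraph" where
  "del_edges G F = G\<lparr>medges := medges G - F\<rparr>"

text \<open>As usual, the one-vertex graph is not \<open>l\<close>-edge-connected for any \<open>l\<close>.\<close>

definition edge_connected :: "nat \<Rightarrow> ('v, 'e) pre_multigraph \<Rightarrow> bool" where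
  "edge_connected l G \<longleftrightarrow>
     card (mverts G) > 1 \<and>
     (\<forall>F. F \<subseteq> medges G \<and> finite F \<and> card F < l \<longrightarrow> mconnected (del_edges G F))"

definition msubgraph :: "('v, 'e) pre_multigraph \<Rightarrow> ('v, 'e) pre_multigraph \<Rightarrow> bool" where
  "msubgraph H G \<longleftrightarrow>
     multigraph H \<and> mverts H \<subseteq> mverts G \<and> medges H \<subseteq> medges G \<and>
     (\<forall>e \<in> medges H. mends H e = mends G e)"

text \<open>Two parallel edges form a cycle of length 2.\<close>

definition cycle_of :: "('v, 'e) pre_multigraph \<Rightarrow> ('v, 'e) pre_multigraph \<Rightarrow> bool" where
  "cycle_of G C \<longleftrightarrow>
     msubgraph C G \<and> mconnected C \<and> (\<forall>v \<in> mverts C. mdegree C v = 2)"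

section \<open>Orientations and flows\<close>

definition orientation_of :: "('v, 'e) pre_multigraph \<Rightarrow> ('v, 'e) pre_digraph \<Rightarrow> bool" where
  "orientation_of G D \<longleftrightarrow>
     verts D = mverts G \<and> arcs D = medges G \<and>
     (\<forall>e \<in> medges G. mends G e = {tail D e, head D e})"

text \<open>Maps on the edge set are represented by extensional functions, so that distinct
  flows differ on some edge.\<close>

definition int_flow :: "('v, 'e) pre_digraph \<Rightarrow> ('e \<Rightarrow> int) \<Rightarrow> bool" where
  "int_flow D f \<longleftrightarrow>
     f \<in> arcs D \<rightarrow>\<^sub>E UNIV \<and>
     (\<forall>v \<in> verts D. (\<Sum>e \<in> out_arcs D v. f e) = (\<Sum>e \<in> in_arcs D v. f e))"

definition k_flow :: "('v, 'e) pre_digraph \<Rightarrow> int \<Rightarrow> ('e \<Rightarrow> int) \<Rightarrow> bool" where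
  "k_flow D k f \<longleftrightarrow> int_flow D f \<and> (\<forall>e \<in> arcs D. \<bar>f e\<bar> < k)"

definition nowhere_zero_k_flow :: "('v, 'e) pre_digraph \<Rightarrow> int \<Rightarrow> ('e \<Rightarrow> int) \<Rightarrow> bool" where
  "nowhere_zero_k_flow D k f \<longleftrightarrow> k_flow D k f \<and> (\<forall>e \<in> arcs D. f e \<noteq> 0)"

definition flow_supp :: "('v, 'e) pre_digraph \<Rightarrow> ('e \<Rightarrow> int) \<Rightarrow> 'e set" where
  "flow_supp D f = {e \<in> arcs D. f e \<noteq> 0}"

text \<open>The reconfiguration graph of \<open>G\<close> with respect to the orientation \<open>D\<close>. It is a simple
  graph, so an edge is the set of its two ends.\<close>

definition flow_graph ::
  "('v, 'e) pre_multigraph \<Rightarrow> ('v, 'e) pre_digraph \<Rightarrow> int \<Rightarrow>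
     ('e \<Rightarrow> int, ('e \<Rightarrow> int) set) pre_multigraph" where
  "flow_graph G D k =
     \<lparr>mverts = {f. nowhere_zero_k_flow D k f},
      medges = {{f, g} | f g. nowhere_zero_k_flow D k f \<and> nowhere_zero_k_flow D k g \<and>
                  (\<exists>C. cycle_of G C \<and> flow_supp D (\<lambda>e. f e - g e) = medges C)},
      mends = (\<lambda>e. e)\<rparr>"

lemma cycle_of_medges_nonempty:
  assumes "cycle_of G C"
  shows "medges C \<noteq> {}"
  using assms by (auto simp: cycle_of_def mconnected_def mdegree_def)

text \<open>Finiteness matters: the cardinality in \<^const>\<open>mdegree\<close> would be 0 for an infinite
  set of edges.\<close>

lemma finite_multigraph_flow_graph:
  assumes G: "finite_multigraph G" and D: "orientation_of G D"
  shows "finite_multigraph (flow_graph G D k)"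
proof -
  interpret finite_multigraph G by (rule G)
  have fin: "finite {f. nowhere_zero_k_flow D k f}"
  proof (rule finite_subset)
    show "{f. nowhere_zero_k_flow D k f} \<subseteq> arcs D \<rightarrow>\<^sub>E {-k..k}"
    proof
      fix f assume "f \<in> {f. nowhere_zero_k_flow D k f}"
      then have ext: "f \<in> extensional (arcs D)" and bound: "\<And>e. e \<in> arcs D \<Longrightarrow> \<bar>f e\<bar> < k"
        by (auto simp: nowhere_zero_k_flow_def k_flow_def int_flow_def PiE_iff)
      have "f e \<in> {-k..k}" if "e \<in> arcs D" for e
        using bound[OF that] by auto
      with ext show "f \<in> arcs D \<rightarrow>\<^sub>E {-k..k}"
        by (simp add: PiE_iff)
    qed
    show "finite (arcs D \<rightarrow>\<^sub>E {-k..k})"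
      using D finite_medges by (auto simp: orientation_of_def intro: finite_PiE)
  qed
  have "medges (flow_graph G D k) \<subseteq> Pow {f. nowhere_zero_k_flow D k f}"
    by (auto simp: flow_graph_def)
  then have fin': "finite (medges (flow_graph G D k))"
    using fin by (meson finite_Pow_iff finite_subset)
  have edge: "e \<subseteq> {f. nowhere_zero_k_flow D k f} \<and> card e = 2"
    if "e \<in> medges (flow_graph G D k)" for e
  proof -
    from that obtain f g C where e: "e = {f, g}"
      and f: "nowhere_zero_k_flow D k f" and g: "nowhere_zero_k_flow D k g"
      and C: "cycle_of G C" "flow_supp D (\<lambda>e. f e - g e) = medges C"
      by (auto simp: flow_graph_def)
    have "f \<noteq> g"
      using cycle_of_medges_nonempty[OF C(1)] C(2) by (auto simp: flow_supp_def)
    then show ?thesis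
      using e f g by simp
  qed
  have "mverts (flow_graph G D k) = {f. nowhere_zero_k_flow D k f}"
    and "\<And>e. mends (flow_graph G D k) e = e"
    by (simp_all add: flow_graph_def)
  then show ?thesis
    using fin fin' edge by unfold_locales simp_all
qed

end

theory Submission
  imports Defs
begin

text \<open>Reverse the arcs on which \<open>f\<close> is negative, so that \<open>f\<close> becomes positive. By conservation
  every vertex then has an outgoing arc, so there is a directed cycle \<open>C\<close>. Subtracting the
  constant \<open>k\<close> along \<open>C\<close> turns values in \<open>{1..k-1}\<close> into values in \<open>{-(k-1)..-1}\<close>, which gives
  another nowhere-zero \<open>k\<close>-flow, differing from \<open>f\<close> exactly on \<open>C\<close>.\<close>

text \<open>The nonempty \<open>N\<close>-invariant subsets form a finite family containing
  \<open>V\<close>, so one is minimal. Minimality replaces tracing an orbit until it first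
  repeats.\<close>

lemma minimal_invariant_set:
  assumes "finite V" "V \<noteq> {}" "N ` V \<subseteq> V"
  obtains S where "S \<subseteq> V" "S \<noteq> {}" "N ` S \<subseteq> S"
    "\<And>T. T \<subseteq> S \<Longrightarrow> T \<noteq> {} \<Longrightarrow> N ` T \<subseteq> T \<Longrightarrow> T = S"
proof -
  let ?A = "{S. S \<subseteq> V \<and> S \<noteq> {} \<and> N ` S \<subseteq> S}"
  have "finite ?A" "?A \<noteq> {}"
    using assms by auto
  then obtain S where S: "S \<in> ?A" and min: "\<And>T. T \<in> ?A \<Longrightarrow> T \<subseteq> S \<Longrightarrow> S = T"
    by (metis (lifting) finite_has_minimal)
  have "T = S" if "T \<subseteq> S" "T \<noteq> {}" "N ` T \<subseteq> T" for T
    using S that min[of T] by auto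
  then show thesis
    using S that[of S] by blast
qed

text \<open>Each vertex selects an edge to its successor \<open>N v\<close>; a minimal invariant set
  is a single periodic orbit of \<open>N\<close>, and its selected edges form the cycle. Injectivity
  of \<open>x\<close> stops one edge from being selected at both ends, so an orbit of length 2
  yields two parallel edges.\<close>

lemma (in multigraph) functional_subgraph_has_cycle:
  assumes fin: "finite V" and ne: "V \<noteq> {}" and V: "V \<subseteq> mverts G"
    and N: "\<And>v. v \<in> V \<Longrightarrow> N v \<in> V"
    and x: "\<And>v. v \<in> V \<Longrightarrow> x v \<in> medges G"
    and ends: "\<And>v. v \<in> V \<Longrightarrow> mends G (x v) = {v, N v}"
    and inj: "inj_on x V"
  obtains S where "S \<subseteq> V" "bij_betw N S S"
    "cycle_of G \<lparr>mverts = S, medges = x ` S, mends = mends G\<rparr>"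
proof -
  obtain S where SV: "S \<subseteq> V" and Sne: "S \<noteq> {}" and NS: "N ` S \<subseteq> S"
    and min: "\<And>T. T \<subseteq> S \<Longrightarrow> T \<noteq> {} \<Longrightarrow> N ` T \<subseteq> T \<Longrightarrow> T = S"
    using minimal_invariant_set[OF fin ne, of N] N by blast
  have finS: "finite S"
    using SV fin by (rule finite_subset)
  \<comment> \<open>The image is again nonempty and invariant, so minimality applies to it.\<close>
  have img: "N ` S = S"
    using min[of "N ` S"] NS Sne by blast
  then have injN: "inj_on N S"
    using finS by (simp add: eq_card_imp_inj_on)
  have bij: "bij_betw N S S"
    using img injN by (simp add: bij_betw_def)
  let ?C = "\<lparr>mverts = S, medges = x ` S, mends = mends G\<rparr>"
  have "mends G (x v) \<subseteq> S \<and> card (mends G (x v)) = 2" if "v \<in> S" for v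
  proof -
    have "v \<in> V"
      using that SV by blast
    then show ?thesis
      using that NS ends card_mends[OF x, of v] by auto
  qed
  then have "multigraph ?C"
    by unfold_locales auto
  then have "msubgraph ?C G"
    using SV V x by (auto simp: msubgraph_def)
  moreover have "mconnected ?C"
    unfolding mconnected_def
  proof (intro conjI ballI)
    fix u v assume u: "u \<in> mverts ?C" and v: "v \<in> mverts ?C"
    \<comment> \<open>Connectedness: the part of \<open>S\<close> reachable from \<open>u\<close> is
      closed under \<open>N\<close>, hence all of \<open>S\<close>.\<close>
    let ?T = "{w \<in> S. (u, w) \<in> (madjacent ?C)\<^sup>*}"
    have "(w, N w) \<in> madjacent ?C" if "w \<in> S" for w
      using that ends SV by (auto simp: madjacent_def)
    then have "N ` ?T \<subseteq> ?T"
      using NS by (auto intro: rtrancl_into_rtrancl)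
    then have "?T = S"
      using u by (intro min) auto
    then show "(u, v) \<in> (madjacent ?C)\<^sup>*"
      using v by auto
  qed (use Sne in simp)
  moreover have "mdegree ?C v = 2" if "v \<in> mverts ?C" for v
  proof -
    have v: "v \<in> S"
      using that by simp
    \<comment> \<open>The predecessor \<open>u\<close> of \<open>v\<close> supplies the second edge
      at \<open>v\<close>.\<close>
    then obtain u where u: "u \<in> S" "N u = v"
      by (metis img imageE)
    have "{e \<in> medges ?C. v \<in> mends ?C e} = {x v, x u}"
    proof -
      have "v \<in> mends G (x w) \<longleftrightarrow> w = v \<or> w = u" if "w \<in> S" for w
      proof -
        have "mends G (x w) = {w, N w}"
          using that SV ends by blast
        moreover have "N w = v \<longleftrightarrow> w = u"
          using inj_on_eq_iff[OF injN that u(1)] u(2) by simp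
        ultimately show ?thesis
          by auto
      qed
      then show ?thesis
        using u v by auto
    qed
    \<comment> \<open>Equality would force \<open>N u = u\<close>, making \<open>x u\<close> a
      loop.\<close>
    moreover have "x v \<noteq> x u"
    proof
      assume "x v = x u"
      then have "v = u"
        using inj_onD[OF inj, of v u] u v SV by auto
      then have "card (mends G (x u)) = 1"
        using u ends SV by auto
      then show False
        using card_mends[OF x, of u] u SV by auto
    qed
    ultimately show ?thesis
      by (simp add: mdegree_def)
  qed
  ultimately show thesis
    using that SV bij by (simp add: cycle_of_def)
qed

definition incidence :: "('v, 'e) pre_digraph \<Rightarrow> 'v \<Rightarrow> 'e \<Rightarrow> int" where
  "incidence D v e = of_bool (tail D e = v) - of_bool (head D e = v)"

text \<open>Flows form the kernel of the signed incidence matrix; with all sums over the same set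
  \<open>arcs D\<close>, conservation becomes visibly linear in \<open>f\<close>.\<close>

lemma int_flow_iff_incidence:
  assumes "finite (arcs D)"
  shows "int_flow D f \<longleftrightarrow>
    f \<in> extensional (arcs D) \<and> (\<forall>v \<in> verts D. (\<Sum>e \<in> arcs D. f e * incidence D v e) = 0)"
proof -
  have "(\<Sum>e \<in> arcs D. f e * incidence D v e)
      = (\<Sum>e \<in> out_arcs D v. f e) - (\<Sum>e \<in> in_arcs D v. f e)" for v
  proof -
    have "(\<Sum>e \<in> arcs D. f e * incidence D v e)
        = (\<Sum>e \<in> arcs D. if tail D e = v then f e else 0)
          - (\<Sum>e \<in> arcs D. if head D e = v then f e else 0)"
      by (subst sum_subtractf[symmetric], rule sum.cong)
        (auto simp: incidence_def algebra_simps)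
    also have "\<dots> = (\<Sum>e \<in> out_arcs D v. f e) - (\<Sum>e \<in> in_arcs D v. f e)"
      using assms by (simp add: sum.inter_filter out_arcs_def in_arcs_def)
    finally show ?thesis .
  qed
  then show ?thesis
    by (auto simp: int_flow_def PiE_iff)
qed

text \<open>A path from \<open>v\<close> to some other vertex must start with an edge at
  \<open>v\<close>.\<close>

lemma edge_connected_incident_edge:
  assumes "edge_connected l G" "l > 0" "v \<in> mverts G"
  obtains e where "e \<in> medges G" "v \<in> mends G e"
proof -
  have "mconnected (del_edges G {})"
    using assms by (auto simp: edge_connected_def)
  moreover obtain u where "u \<in> mverts G" "u \<noteq> v"
    using assms by (metis card_le_Suc0_iff_eq card.infinite edge_connected_def
        less_nat_zero_code linorder_not_less One_nat_def)
  ultimately have "(v, u) \<in> (madjacent G)\<^sup>*" "u \<noteq> v"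
    using assms(3) by (auto simp: mconnected_def del_edges_def)
  then obtain w where "(v, w) \<in> madjacent G"
    by (metis converse_rtranclE)
  then show thesis
    using that by (auto simp: madjacent_def)
qed

text \<open>The tail of \<open>e\<close> once arcs are reversed so that \<open>f\<close> takes the
  value \<open>\<bar>f e\<bar>\<close>. The value 0 falls into the reversed case, but only nonzero
  values occur below.\<close>

definition pos_tail :: "('v, 'e) pre_digraph \<Rightarrow> ('e \<Rightarrow> int) \<Rightarrow> 'e \<Rightarrow> 'v" where
  "pos_tail D f e = (if f e > 0 then tail D e else head D e)"

definition pos_head :: "('v, 'e) pre_digraph \<Rightarrow> ('e \<Rightarrow> int) \<Rightarrow> 'e \<Rightarrow> 'v" where
  "pos_head D f e = (if f e > 0 then head D e else tail D e)"

text \<open>Multiplying an incidence column by the sign of \<open>f e\<close> is the same as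
  reversing the arc when \<open>f e\<close> is negative.\<close>

lemma sgn_mult_incidence:
  assumes "f e \<noteq> 0"
  shows "sgn (f e) * incidence D v e = of_bool (pos_tail D f e = v) - of_bool (pos_head D f e = v)"
  using assms by (auto simp: incidence_def pos_tail_def pos_head_def sgn_if)

text \<open>Otherwise every arc at \<open>v\<close> would point into \<open>v\<close>, and
  \<open>a\<close> alone would make the net inflow of \<open>\<bar>f\<bar>\<close> positive.\<close>

lemma exists_pos_out_arc:
  assumes fin: "finite (arcs D)" and flow: "int_flow D f" and v: "v \<in> verts D"
    and nz: "\<And>e. e \<in> arcs D \<Longrightarrow> f e \<noteq> 0"
    and a: "a \<in> arcs D" "v \<in> {tail D a, head D a}"
  obtains e where "e \<in> arcs D" "pos_tail D f e = v"
proof (rule ccontr)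
  assume "\<not> thesis"
  then have no: "pos_tail D f e \<noteq> v" if "e \<in> arcs D" for e
    using that \<open>\<And>e. e \<in> arcs D \<Longrightarrow> pos_tail D f e = v \<Longrightarrow> thesis\<close> by blast
  have eq: "f e * incidence D v e = - \<bar>f e\<bar> * of_bool (pos_head D f e = v)"
    if "e \<in> arcs D" for e
  proof -
    have "f e * incidence D v e = \<bar>f e\<bar> * (sgn (f e) * incidence D v e)"
      by (metis abs_mult_sgn mult.assoc)
    then show ?thesis
      using no[OF that] by (simp add: sgn_mult_incidence[of f, OF nz[OF that]])
  qed
  have "(\<Sum>e \<in> arcs D. \<bar>f e\<bar> * of_bool (pos_head D f e = v)) = 0"
    using flow v eq by (auto simp: int_flow_iff_incidence[OF fin] sum_negf)
  then have "\<bar>f a\<bar> * of_bool (pos_head D f a = v) = 0"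
    using fin a(1) by (subst (asm) sum_nonneg_eq_0_iff) auto
  then have "pos_head D f a \<noteq> v"
    using nz[OF a(1)] by auto
  then show False
    using no[OF a(1)] a(2) by (auto simp: pos_tail_def pos_head_def split: if_splits)
qed

text \<open>The balance equation expresses that \<open>C\<close> is a directed cycle after the
  reversal: \<open>sgn (f e)\<close> on \<open>C\<close>, extended by 0, is a circulation.\<close>

lemma nowhere_zero_flow_pos_cycle:
  assumes G: "finite_multigraph G" and conn: "edge_connected 2 G" and D: "orientation_of G D"
    and f: "nowhere_zero_k_flow D k f"
  obtains C where "cycle_of G C"
    "\<And>v. (\<Sum>e \<in> medges C. sgn (f e) * incidence D v e) = 0"
proof -
  interpret finite_multigraph G by (rule G)
  have D': "verts D = mverts G" "arcs D = medges G"
    "\<And>e. e \<in> medges G \<Longrightarrow> mends G e = {tail D e, head D e}"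
    using D by (auto simp: orientation_of_def)
  have nz: "f e \<noteq> 0" if "e \<in> medges G" for e
    using f that D' by (auto simp: nowhere_zero_k_flow_def)
  have ends: "mends G e = {pos_tail D f e, pos_head D f e}" if "e \<in> medges G" for e
    using D'(3)[OF that] by (auto simp: pos_tail_def pos_head_def)
  have "\<exists>e. e \<in> medges G \<and> pos_tail D f e = v" if v: "v \<in> mverts G" for v
  proof -
    obtain a where "a \<in> medges G" "v \<in> mends G a"
      using edge_connected_incident_edge[OF conn _ v] by auto
    then show ?thesis
      using exists_pos_out_arc[of D f v a] finite_medges v f D' nz
      by (metis k_flow_def nowhere_zero_k_flow_def)
  qed
  then obtain x where x: "x v \<in> medges G" "pos_tail D f (x v) = v" if "v \<in> mverts G" for v
    by metis
  define N where "N v = pos_head D f (x v)" for v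
  have "mverts G \<noteq> {}"
    using conn by (auto simp: edge_connected_def)
  moreover have xends: "mends G (x v) = {v, N v}" if "v \<in> mverts G" for v
    using ends x[OF that] by (simp add: N_def)
  moreover have "N v \<in> mverts G" if "v \<in> mverts G" for v
    using mends_in_mverts[OF x(1)] xends that by auto
  \<comment> \<open>\<open>pos_tail D f\<close> is a left inverse of \<open>x\<close>.\<close>
  moreover have injx: "inj_on x (mverts G)"
    by (metis inj_onI x(2))
  ultimately obtain S where S: "S \<subseteq> mverts G" "bij_betw N S S"
    "cycle_of G \<lparr>mverts = S, medges = x ` S, mends = mends G\<rparr>"
    using functional_subgraph_has_cycle[of "mverts G" N x] finite_mverts x(1) by blast
  have "(\<Sum>e \<in> x ` S. sgn (f e) * incidence D v e) = 0" for v
  proof -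
    have "(\<Sum>e \<in> x ` S. sgn (f e) * incidence D v e)
        = (\<Sum>u \<in> S. sgn (f (x u)) * incidence D v (x u))"
      using inj_on_subset[OF injx S(1)] by (simp add: sum.reindex)
    also have "\<dots> = (\<Sum>u \<in> S. of_bool (u = v) - of_bool (N u = v))"
    proof (rule sum.cong)
      fix u assume "u \<in> S"
      then have "x u \<in> medges G" "pos_tail D f (x u) = u"
        using x S(1) by auto
      then show "sgn (f (x u)) * incidence D v (x u) = of_bool (u = v) - of_bool (N u = v)"
        by (simp only: sgn_mult_incidence[of f, OF nz] N_def)
    qed simp
    also have "\<dots> = (\<Sum>u \<in> S. of_bool (u = v)) - (\<Sum>u \<in> S. of_bool (N u = v))"
      by (rule sum_subtractf)
    \<comment> \<open>\<open>N\<close> permutes \<open>S\<close>, so each vertex of \<open>S\<close>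
      is a tail once and a head once.\<close>
    also have "\<dots> = 0"
      using sum.reindex_bij_betw[OF S(2), of "\<lambda>u. of_bool (u = v) :: int"] by simp
    finally show ?thesis .
  qed
  then show thesis
    using that[OF S(3)] by simp
qed

theorem theorem3p4:
  fixes G :: "('v, 'e) pre_multigraph"
    and D :: "('v, 'e) pre_digraph"
    and k :: int
  assumes "finite_multigraph G"
    and "edge_connected 2 G"
    and "orientation_of G D"
    and "k \<ge> 2"
    and "mverts (flow_graph G D k) \<noteq> {}"
  shows "\<forall>f \<in> mverts (flow_graph G D k). mdegree (flow_graph G D k) f \<ge> 1"
proof
  fix f assume "f \<in> mverts (flow_graph G D k)"
  then have f: "nowhere_zero_k_flow D k f"
    by (simp add: flow_graph_def)
  interpret finite_multigraph G by fact
  have fin: "finite (arcs D)"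
    using assms(3) finite_medges by (simp add: orientation_of_def)
  obtain C where C: "cycle_of G C"
    and bal: "\<And>v. (\<Sum>e \<in> medges C. sgn (f e) * incidence D v e) = 0"
    using nowhere_zero_flow_pos_cycle[OF assms(1-3) f] by blast
  have CD: "medges C \<subseteq> arcs D"
    using C assms(3) by (auto simp: cycle_of_def msubgraph_def orientation_of_def)
  have fE: "f e \<noteq> 0" "\<bar>f e\<bar> < k" if "e \<in> arcs D" for e
    using f that by (auto simp: nowhere_zero_k_flow_def k_flow_def)
  have ff: "f \<in> extensional (arcs D)"
    "\<And>v. v \<in> verts D \<Longrightarrow> (\<Sum>e \<in> arcs D. f e * incidence D v e) = 0"
    using f by (auto simp: nowhere_zero_k_flow_def k_flow_def int_flow_iff_incidence[OF fin])
  \<comment> \<open>In the fixed orientation, subtracting \<open>k\<close> along the directed cycle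
    carries the factor \<open>sgn (f e)\<close>.\<close>
  define g where "g e = (if e \<in> medges C then f e - k * sgn (f e) else f e)" for e
  have "g \<in> extensional (arcs D)"
    using ff(1) CD by (auto simp: g_def extensional_def)
  moreover have "(\<Sum>e \<in> arcs D. g e * incidence D v e) = 0" if "v \<in> verts D" for v
  proof -
    have "(\<Sum>e \<in> arcs D. g e * incidence D v e)
        = (\<Sum>e \<in> arcs D. f e * incidence D v e
            - k * (if e \<in> medges C then sgn (f e) * incidence D v e else 0))"
      by (intro sum.cong) (auto simp: g_def algebra_simps)
    also have "\<dots> = (\<Sum>e \<in> arcs D. f e * incidence D v e)
        - k * (\<Sum>e \<in> arcs D. if e \<in> medges C then sgn (f e) * incidence D v e else 0)"
      by (simp add: sum_subtractf sum_distrib_left)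
    also have "(\<Sum>e \<in> arcs D. if e \<in> medges C then sgn (f e) * incidence D v e else 0)
        = (\<Sum>e \<in> medges C. sgn (f e) * incidence D v e)"
      using fin CD by (simp add: sum.inter_restrict[symmetric] Int_absorb1)
    finally show ?thesis
      using ff(2)[OF that] bal by simp
  qed
  ultimately have "int_flow D g"
    by (simp add: int_flow_iff_incidence[OF fin])
  \<comment> \<open>On \<open>C\<close> the sign flips and
    \<open>\<bar>g e\<bar> = k - \<bar>f e\<bar>\<close>, which lies in
    \<open>{1..k-1}\<close>.\<close>
  moreover have "g e \<noteq> 0 \<and> \<bar>g e\<bar> < k" if "e \<in> arcs D" for e
    using fE[OF that] by (auto simp: g_def sgn_if)
  ultimately have g: "nowhere_zero_k_flow D k g"
    by (simp add: nowhere_zero_k_flow_def k_flow_def)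
  have "flow_supp D (\<lambda>e. f e - g e) = medges C"
    using CD fE \<open>k \<ge> 2\<close> by (auto simp: flow_supp_def g_def sgn_if)
  then have "{f, g} \<in> medges (flow_graph G D k)"
    using f g C by (auto simp: flow_graph_def)
  then have "{e \<in> medges (flow_graph G D k). f \<in> mends (flow_graph G D k) e} \<noteq> {}"
    by (auto simp: flow_graph_def)
  \<comment> \<open>Needed to pass from a nonempty set of incident edges to positive
    \<open>card\<close>, which is 0 on infinite sets.\<close>
  moreover have "finite (medges (flow_graph G D k))"
    using finite_multigraph_flow_graph[OF assms(1,3)] by (rule finite_multigraph.finite_medges)
  ultimately show "mdegree (flow_graph G D k) f \<ge> 1"
    by (simp add: mdegree_def Suc_le_eq card_gt_0_iff)
qed

end
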